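(* Let $(M_i)_{i\ge 1}$ be an increasing sequence of positive integers with $M_i\to\infty$, and let $q_1=2$, $q_{i+1}=q_i^{M_i}$ for $i\ge 1$. Let $\phi:[2,\infty)\to(0,\infty)$ be monotone increasing with $\phi(t)\to\infty$ as $t\to\infty$. For each $i\ge 1$ define $$G_i=\frac{1}{q_i}\big([0,q_i]\cap\mathbb Z\big),\qquad r_i=q_i^{-\phi(q_i)},\qquad E_i=\{x\in[0,1]:\operatorname{dist}(x,G_i)\le r_i\},$$ and set $E=\bigcap_{i=1}^\infty E_i$. If $\phi(q_i)<M_i-1$ for all sufficiently large $i$, then there exists an infinite set $A\subset E$ such that $A+A+A\subset E$. Consequently, $E$ satisfies the conclusion of the Erdős similarity conjecture.
   Context: $A+A+A=\{a+b+c: a,b,c\in A\}$. A set $C\subset\mathbb R$ satisfies the conclusion of the Erdős similarity conjecture if there exists a Lebesgue measurable set $F\subset\mathbb R$ of positive Lebesgue measure which contains no affine copy of $C$, i.e. no set of the form $x+tC=\{x+tc:c\in C\}$ with $x\in\mathbb R$, $t\in\mathbb R\setminus\{0\}$. *)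

theory Defs
  imports "HOL-Analysis.Analysis" "HOL-Library.Set_Algebras"
begin

definition grid :: "nat \<Rightarrow> real set" where
  "grid m = (\<lambda>k::int. real_of_int k / real m) ` {0..int m}"

definition radius :: "(real \<Rightarrow> real) \<Rightarrow> nat \<Rightarrow> real" where
  "radius \<phi> m = real m powr (- \<phi> (real m))"

definition grid_nbhd :: "(real \<Rightarrow> real) \<Rightarrow> nat \<Rightarrow> real set" where
  "grid_nbhd \<phi> m = {x \<in> {0..1}. infdist x (grid m) \<le> radius \<phi> m}"

text \<open>The sequence \<open>q\<close> is indexed from 1; the value \<open>q 0\<close> plays no role.\<close>

definition E_set :: "(real \<Rightarrow> real) \<Rightarrow> (nat \<Rightarrow> nat) \<Rightarrow> real set" where
  "E_set \<phi> q = (\<Inter>i\<in>{1..}. grid_nbhd \<phi> (q i))"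

definition erdos_similarity_conclusion :: "real set \<Rightarrow> bool" where
  "erdos_similarity_conclusion C \<longleftrightarrow>
    (\<exists>F. F \<in> sets lebesgue \<and> emeasure lebesgue F > 0 \<and>
      \<not> (\<exists>x t. t \<noteq> 0 \<and> (\<lambda>c. x + t * c) ` C \<subseteq> F))"

end

theory Submission
  imports Defs
begin

text \<open>
  Every multiple of \<open>1 / q n\<close> lies in \<open>G\<^sub>i\<close> for \<open>i \<ge> n\<close>, and for \<open>i < n\<close> a multiple \<open>k / q n\<close> with
  \<open>k \<le> q (n - 1)\<close> is within \<open>r\<^sub>i\<close> of the grid point \<open>0\<close>, because \<open>\<phi> (q (n - 1)) < M (n - 1) - 1\<close>.
  Hence \<open>A = {1 / q n | n \<ge> N}\<close> works for large \<open>N\<close>.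

  For the similarity conclusion, Bourgain's theorem on triple sums is not needed: by the same
  observation \<open>E\<close> contains the arithmetic progressions \<open>{k / q n | k \<le> q (n - 1)}\<close>, whose lengths
  tend to infinity and whose steps tend to \<open>0\<close>. A progression with step \<open>d\<close> and length \<open>L\<close>, scaled by
  \<open>t\<close> with \<open>1/T \<le> \<bar>t\<bar> \<le> T\<close>, meets every periodic family of intervals of width \<open>T d\<close> and period
  \<open>L d / T\<close>. Such a family has density \<open>T\<^sup>2 / L\<close>, so deleting one for each \<open>T = 1, 2, \<dots>\<close> from
  \<open>[0, 1]\<close>, with \<open>L\<close> growing fast enough, leaves a set of positive measure.
\<close>

section \<open>Sets containing long arithmetic progressions\<close>

definition comb :: "real \<Rightarrow> real \<Rightarrow> real set" where
  "comb p w = (\<Union>m::int. {of_int m * p..<of_int m * p + w})"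

lemma comb_sets [measurable]: "comb p w \<in> sets borel"
  unfolding comb_def by measurable

text \<open>At most \<open>\<lfloor>1 / p\<rfloor> + 1 \<le> 2 / p\<close> teeth meet the unit
  interval, and each has measure \<open>w\<close>.\<close>

lemma emeasure_comb_le:
  assumes "0 < p" "p \<le> 1" "0 \<le> w" "w \<le> p"
  shows "emeasure lborel ({0..1} \<inter> comb p w) \<le> ennreal (2 * w / p)"
proof -
  let ?K = "nat \<lfloor>1 / p\<rfloor>"
  have "{0..1} \<inter> comb p w \<subseteq> (\<Union>k\<in>{..?K}. {real k * p..real k * p + w})"
  proof
    fix y assume y: "y \<in> {0..1} \<inter> comb p w"
    then obtain m :: int where m: "of_int m * p \<le> y" "y < of_int m * p + w"
      by (auto simp: comb_def)
    \<comment> \<open>Since teeth are open on the right and \<open>w \<le> p\<close>, those with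
      negative \<open>m\<close> end before reaching 0.\<close>
    have "0 < (of_int m + 1) * p"
      using m y assms by (simp add: algebra_simps)
    hence "0 < of_int m + (1::real)"
      using assms by (simp add: zero_less_mult_iff)
    hence m0: "0 \<le> m" by linarith
    have "of_int m \<le> 1 / p"
      using m y assms by (simp add: field_simps)
    hence "m \<le> \<lfloor>1 / p\<rfloor>" by linarith
    hence "nat m \<in> {..?K}" by auto
    moreover have "y \<in> {real (nat m) * p..real (nat m) * p + w}"
      using m m0 by simp
    ultimately show "y \<in> (\<Union>k\<in>{..?K}. {real k * p..real k * p + w})" by blast
  qed
  hence "emeasure lborel ({0..1} \<inter> comb p w)
      \<le> emeasure lborel (\<Union>k\<in>{..?K}. {real k * p..real k * p + w})"
    by (intro emeasure_mono) auto
  also have "\<dots> \<le> (\<Sum>k\<in>{..?K}. emeasure lborel {real k * p..real k * p + w})"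
    by (intro emeasure_subadditive_finite) auto
  also have "\<dots> = ennreal (real (Suc ?K) * w)"
    using assms by (simp add: ennreal_mult ennreal_of_nat_eq_real_of_nat flip: ennreal_plus)
  also have "\<dots> \<le> ennreal (2 * w / p)"
  proof (intro ennreal_leI)
    have "1 \<le> 1 / p" using assms by simp
    hence "real (Suc ?K) \<le> 2 / p"
      using of_int_floor_le[of "1 / p"] by (simp; linarith)
    hence "real (Suc ?K) * w \<le> 2 / p * w"
      by (intro mult_right_mono) (use assms in auto)
    thus "real (Suc ?K) * w \<le> 2 * w / p" by simp
  qed
  finally show ?thesis .
qed

text \<open>Steps no longer than a tooth cannot jump over it, and a walk spanning a full period
  reaches the next tooth.\<close>

lemma progression_meets_comb:
  assumes "0 < D" "D \<le> w" "0 < p" "p \<le> real L * D"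
  obtains k where "k \<le> L" "b + real k * D \<in> comb p w"
proof -
  \<comment> \<open>Tooth \<open>m\<close> is the first to start at or after \<open>b\<close>, and
    \<open>k\<close> is the first index at or beyond that start. The overshoot is less than
    \<open>D \<le> w\<close>.\<close>
  define m where "m = \<lceil>b / p\<rceil>"
  define k where "k = \<lceil>(of_int m * p - b) / D\<rceil>"
  have "b / p \<le> of_int m" "of_int m < b / p + 1"
    unfolding m_def by linarith+
  hence m: "b \<le> of_int m * p" "of_int m * p < b + p"
    using assms by (simp_all add: field_simps)
  have "(of_int m * p - b) / D \<le> of_int k" "of_int k < (of_int m * p - b) / D + 1"
    unfolding k_def by linarith+
  hence k: "of_int m * p - b \<le> of_int k * D" "of_int k * D < of_int m * p - b + D"
    using assms by (simp_all add: field_simps)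
  have "0 \<le> (of_int m * p - b) / D" using m assms by simp
  hence k0: "0 \<le> k" unfolding k_def by linarith
  have "(of_int m * p - b) / D \<le> real L"
    using m assms by (simp add: field_simps)
  hence "k \<le> int L" unfolding k_def by linarith
  show thesis
  proof
    show "nat k \<le> L" using \<open>k \<le> int L\<close> by simp
    show "b + real (nat k) * D \<in> comb p w"
      unfolding comb_def using k k0 assms by (intro UN_I[of m]) auto
  qed
qed

theorem erdos_similarity_if_long_progressions:
  assumes AP: "\<And>L e. 0 < e \<Longrightarrow> \<exists>a d. 0 < d \<and> d \<le> e \<and> (\<forall>k\<le>L. a + real k * d \<in> C)"
  shows "erdos_similarity_conclusion C"
proof -
  define T :: "nat \<Rightarrow> nat" where "T n = Suc n" for n
  \<comment> \<open>This makes \<open>2 * w n / p n\<close>, the bound on the measure removed at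
    stage \<open>n\<close>, equal to \<open>(1 / 2) ^ (n + 2)\<close>; these sum to 1/2.\<close>
  define L where "L n = T n ^ 2 * 2 ^ (n + 3)" for n
  \<comment> \<open>The bound on \<open>d\<close> keeps the period \<open>p n\<close> at most 1, as
    the tooth count requires.\<close>
  have "\<exists>a d. 0 < d \<and> d \<le> real (T n) / real (L n) \<and> (\<forall>k\<le>L n. a + real k * d \<in> C)" for n
    by (intro AP) (simp add: L_def T_def)
  then obtain a d where d: "\<And>n. 0 < d n" "\<And>n. d n \<le> real (T n) / real (L n)"
      and AP': "\<And>n k. k \<le> L n \<Longrightarrow> a n + real k * d n \<in> C"
    by metis
  define p where "p n = real (L n) * d n / real (T n)" for n
  define w where "w n = real (T n) * d n" for n
  define U where "U n = {0..1} \<inter> comb (p n) (w n)" for n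
  have Tpos: "0 < real (T n)" and Lpos: "0 < real (L n)" for n
    by (simp_all add: L_def T_def)
  have ppos: "0 < p n" and wpos: "0 < w n" and p1: "p n \<le> 1" for n
    using d[of n] Tpos[of n] Lpos[of n] by (simp_all add: p_def w_def field_simps)
  have ratio: "2 * w n / p n = (1 / 2) ^ (n + 2)" for n
    using d(1)[of n] Tpos[of n]
    by (simp add: p_def w_def L_def field_simps power2_eq_square power_add)
  have wp: "w n \<le> p n" for n
  proof -
    have "2 * w n / p n \<le> 1"
      unfolding ratio by (intro power_le_one) auto
    thus ?thesis using ppos[of n] wpos[of n] by (simp add: field_simps)
  qed
  have U_sets [measurable]: "U n \<in> sets borel" for n
    unfolding U_def by measurable
  have "emeasure lborel (\<Union>n. U n) \<le> (\<Sum>n. emeasure lborel (U n))"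
    by (intro emeasure_subadditive_countably) auto
  also have "\<dots> \<le> (\<Sum>n. ennreal ((1 / 2) ^ (n + 2)))"
  proof (intro suminf_le summableI)
    show "emeasure lborel (U n) \<le> ennreal ((1 / 2) ^ (n + 2))" for n
      using emeasure_comb_le[OF ppos p1 less_imp_le[OF wpos] wp, of n]
      unfolding U_def ratio .
  qed
  also have "\<dots> = ennreal (1 / 2)"
  proof (rule suminf_ennreal_eq)
    have "(\<lambda>n. (1 / 2) ^ n * (1 / 2) ^ 2) sums (1 / (1 - 1 / 2) * (1 / 2 :: real) ^ 2)"
      by (intro sums_mult2 geometric_sums) auto
    thus "(\<lambda>n. (1 / 2) ^ (n + 2)) sums (1 / 2 :: real)"
      by (simp add: power_add power2_eq_square)
  qed auto
  finally have U_small: "emeasure lborel (\<Union>n. U n) \<le> ennreal (1 / 2)" .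
  define F where "F = {0..1::real} - (\<Union>n. U n)"
  have F_sets [measurable]: "F \<in> sets borel"
    unfolding F_def by measurable
  have "emeasure lborel F > 0"
  proof (rule ccontr)
    assume "\<not> emeasure lborel F > 0"
    hence F0: "emeasure lborel F = 0" by simp
    have "emeasure lborel {0..1::real} \<le> emeasure lborel (F \<union> (\<Union>n. U n))"
      by (intro emeasure_mono) (auto simp: F_def)
    also have "\<dots> \<le> emeasure lborel F + emeasure lborel (\<Union>n. U n)"
      by (intro emeasure_subadditive) auto
    also have "\<dots> \<le> ennreal (1 / 2)"
      using F0 U_small by simp
    finally have "ennreal 1 \<le> ennreal (1 / 2)" by simp
    thus False by (subst (asm) ennreal_le_iff) auto
  qed
  moreover have "\<not> (\<lambda>c. x + t * c) ` C \<subseteq> F" if "t \<noteq> 0" for x t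
  proof
    assume sub: "(\<lambda>c. x + t * c) ` C \<subseteq> F"
    \<comment> \<open>The bound on \<open>\<bar>t\<bar>\<close> will give
      \<open>D \<le> w n\<close>, the one on its reciprocal
      \<open>p n \<le> L n * D\<close>.\<close>
    define n where "n = nat \<lceil>max \<bar>t\<bar> (1 / \<bar>t\<bar>)\<rceil>"
    have "max \<bar>t\<bar> (1 / \<bar>t\<bar>) \<le> real (T n)"
      unfolding n_def T_def by linarith
    hence t: "\<bar>t\<bar> \<le> real (T n)" "1 / \<bar>t\<bar> \<le> real (T n)" by simp_all
    define D where "D = \<bar>t\<bar> * d n"
    have D: "0 < D" "D \<le> w n"
      using t d(1)[of n] that by (auto simp: D_def w_def)
    have "1 \<le> \<bar>t\<bar> * real (T n)"
      using t(2) that by (simp add: field_simps)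
    hence "1 / real (T n) \<le> \<bar>t\<bar>"
      using Tpos[of n] by (simp add: field_simps)
    hence "1 / real (T n) * (real (L n) * d n) \<le> \<bar>t\<bar> * (real (L n) * d n)"
      using d(1)[of n] by (intro mult_right_mono) (auto simp: less_imp_le)
    hence pD: "p n \<le> real (L n) * D"
      by (simp add: p_def D_def mult_ac)
    have AP_F: "x + t * (a n + real k * d n) \<in> F" if "k \<le> L n" for k
      using AP'[OF that] sub by blast
    \<comment> \<open>A negative \<open>t\<close> reverses the progression, so it is read from its
      last term, which is now the least.\<close>
    define b where "b = (if t > 0 then x + t * a n else x + t * (a n + real (L n) * d n))"
    have "b + real k * D \<in> F" if k: "k \<le> L n" for k
    proof (cases "t > 0")
      case True
      thus ?thesis using AP_F[OF k] by (simp add: b_def D_def algebra_simps)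
    next
      case False
      have "b + real k * D = x + t * (a n + real (L n - k) * d n)"
        using False k by (simp add: b_def D_def of_nat_diff algebra_simps)
      thus ?thesis using AP_F[of "L n - k"] by simp
    qed
    moreover obtain k where "k \<le> L n" "b + real k * D \<in> comb (p n) (w n)"
      using progression_meets_comb[OF D ppos pD] .
    ultimately show False
      by (auto simp: F_def U_def)
  qed
  ultimately show ?thesis
    unfolding erdos_similarity_conclusion_def
    by (intro exI[of _ F]) auto
qed

section \<open>Points of \<open>E\<close>\<close>

text \<open>Approximating from below lets numerators and errors simply add under sums;
  \<open>x \<le> 1\<close> then keeps the numerator within the range of the grid.\<close>

lemma E_setI:
  assumes q: "\<And>i. 1 \<le> i \<Longrightarrow> 0 < q i" and "x \<le> 1"
    and g: "\<And>i. 1 \<le> i \<Longrightarrow>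
      \<exists>g::nat. real g / real (q i) \<le> x \<and> x \<le> real g / real (q i) + radius \<phi> (q i)"
  shows "x \<in> E_set \<phi> q"
  unfolding E_set_def
proof (intro INT_I)
  fix i :: nat assume "i \<in> {1..}"
  hence i: "1 \<le> i" by simp
  obtain g :: nat where g: "real g / real (q i) \<le> x" "x \<le> real g / real (q i) + radius \<phi> (q i)"
    using g[OF i] by blast
  have "real g / real (q i) \<le> 1" using g(1) \<open>x \<le> 1\<close> by linarith
  hence "g \<le> q i" using q[OF i] by simp
  hence "real g / real (q i) \<in> grid (q i)"
    unfolding grid_def by (intro image_eqI[of _ _ "int g"]) auto
  hence "infdist x (grid (q i)) \<le> radius \<phi> (q i)"
    by (rule infdist_le2) (use g in \<open>simp add: dist_real_def\<close>)
  moreover have "0 \<le> real g / real (q i)" by simp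
  hence "0 \<le> x" using g(1) by linarith
  ultimately show "x \<in> grid_nbhd \<phi> (q i)"
    using \<open>x \<le> 1\<close> by (simp add: grid_nbhd_def)
qed

text \<open>Base and exponent of \<open>m powr \<phi> m\<close> both grow. Hence an error within the
  radius at one level is within it at all earlier levels.\<close>

lemma radius_antimono:
  assumes "mono_on {2..} \<phi>" "\<And>t. t \<ge> 2 \<Longrightarrow> \<phi> t > 0" "2 \<le> m" "m \<le> n"
  shows "radius \<phi> n \<le> radius \<phi> m"
proof -
  have "\<phi> (real m) \<le> \<phi> (real n)"
    using assms by (intro mono_onD[OF assms(1)]) auto
  hence "real m powr \<phi> (real m) \<le> real n powr \<phi> (real n)"
    using assms assms(2)[of "real m"] by (intro powr_mono_both) (auto simp: less_imp_le)
  thus ?thesis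
    using assms by (simp add: radius_def powr_minus le_imp_inverse_le)
qed

theorem theorem1p2:
  fixes M q :: "nat \<Rightarrow> nat" and \<phi> :: "real \<Rightarrow> real"
  assumes M_pos: "\<And>i. i \<ge> 1 \<Longrightarrow> M i > 0"
    and M_mono: "mono_on {1..} M"
    and M_lim: "filterlim M at_top sequentially"
    and q_1: "q 1 = 2"
    and q_Suc: "\<And>i. i \<ge> 1 \<Longrightarrow> q (Suc i) = q i ^ M i"
    and phi_pos: "\<And>t. t \<ge> 2 \<Longrightarrow> \<phi> t > 0"
    and phi_mono: "mono_on {2..} \<phi>"
    and phi_lim: "filterlim \<phi> at_top at_top"
    and phi_less: "\<forall>\<^sub>F i in sequentially. \<phi> (real (q i)) < real (M i) - 1"
  shows "(\<exists>A. infinite A \<and> A \<subseteq> E_set \<phi> q \<and> A + A + A \<subseteq> E_set \<phi> q)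
    \<and> erdos_similarity_conclusion (E_set \<phi> q)"
proof -

  \<comment> \<open>Divisibility and growth of \<open>q\<close>\<close>
  have q_dvd_Suc: "q i dvd q (Suc i)" if "1 \<le> i" for i
    using M_pos[OF that] q_Suc[OF that] by (auto intro: dvd_power)
  have q_dvd: "q i dvd q j" if "1 \<le> i" "i \<le> j" for i j
    using that(2,1) by (induction rule: dec_induct) (use q_dvd_Suc dvd_trans in \<open>force+\<close>)
  have q_pos: "0 < q i" if "1 \<le> i" for i
    using that by (induction rule: dec_induct) (use q_1 q_Suc in auto)
  have q_le: "q i \<le> q j" if "1 \<le> i" "i \<le> j" for i j
    using q_dvd[OF that] q_pos[of j] that by (intro dvd_imp_le) auto
  have q_ge2: "2 \<le> q i" if "1 \<le> i" for i
    using q_le[of 1 i] q_1 that by simp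
  obtain N where N: "1 \<le> N" "\<And>i. N \<le> i \<Longrightarrow> \<phi> (real (q i)) < real (M i) - 1"
    using eventually_conj[OF phi_less eventually_ge_at_top[of 1]]
    unfolding eventually_sequentially by (metis le_refl)
  have step: "2 * q i \<le> q (Suc i)" if "N \<le> i" for i
  proof -
    have i: "1 \<le> i" using N that by simp
    have "0 < \<phi> (real (q i))" using q_ge2[OF i] by (intro phi_pos) simp
    hence "2 \<le> M i" using N(2)[OF that] by linarith
    hence "q i ^ 2 \<le> q (Suc i)"
      unfolding q_Suc[OF i] using q_pos[OF i] by (intro power_increasing) auto
    moreover have "2 * q i \<le> q i ^ 2"
      using q_ge2[OF i] by (simp add: power2_eq_square)
    ultimately show ?thesis by linarith
  qed
  have grow: "k < q (N + k)" for k
  proof (induction k)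
    case 0
    thus ?case using q_pos N by simp
  next
    case (Suc k)
    thus ?case using step[of "N + k"] by simp
  qed
  have q_less: "q i < q j" if "N \<le> i" "i < j" for i j
    using step[OF that(1)] q_pos[of i] q_le[of "Suc i" j] that N by simp
  \<comment> \<open>The quotient is \<open>q n\<close> to the power \<open>1 - M n\<close>, so
    \<open>\<phi> (q n) < M n - 1\<close> bounds it by the radius at \<open>n\<close>, the smallest
    among those at \<open>i \<le> n\<close>.\<close>
  have near_0: "real (q n) / real (q (Suc n)) \<le> radius \<phi> (q i)" if "N \<le> n" "1 \<le> i" "i \<le> n" for i n
  proof -
    have n: "1 \<le> n" using that by simp
    have "real (q n) / real (q (Suc n)) = real (q n) powr (1 - real (M n))"
      using q_pos[OF n] by (simp add: q_Suc[OF n] powr_diff powr_realpow)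
    also have "\<dots> \<le> real (q n) powr (- \<phi> (real (q n)))"
      using q_pos[OF n] N(2)[OF that(1)] by (intro powr_mono) auto
    also have "\<dots> \<le> radius \<phi> (q i)"
      unfolding radius_def[symmetric]
      by (rule radius_antimono[OF phi_mono phi_pos]) (use q_ge2 q_le that in auto)
    finally show ?thesis .
  qed

  \<comment> \<open>An infinite set with triple sums in \<open>E_set\<close>\<close>
  define B where "B = {1 / real (q n) | n. N + 3 \<le> n}"
  \<comment> \<open>Only a third of the radius is spent, so that three errors fit in a sum.\<close>
  have B_approx: "\<exists>g::nat. real g / real (q i) \<le> x \<and> x \<le> real g / real (q i) + radius \<phi> (q i) / 3"
    if "x \<in> B" "1 \<le> i" for x i
  proof -
    obtain n where n: "N + 3 \<le> n" "x = 1 / real (q n)"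
      using \<open>x \<in> B\<close> by (auto simp: B_def)
    show ?thesis
    proof (cases "n \<le> i")
      case True
      have n1: "1 \<le> n" using n N by simp
      have "x = real (q i div q n) / real (q i)"
        using q_dvd[OF n1 True] q_pos[OF n1] q_pos[OF \<open>1 \<le> i\<close>] n by (simp add: real_of_nat_div)
      moreover have "0 \<le> radius \<phi> (q i)" by (simp add: radius_def)
      ultimately show ?thesis by (intro exI[of _ "q i div q n"]) simp
    next
      case False
      obtain m where m: "n = Suc m" "N + 2 \<le> m"
        using n by (cases n) auto
      \<comment> \<open>The shift by 3 in \<open>B\<close> serves this: \<open>m \<ge> N + 2\<close>
        and \<open>q (N + 2) > 2\<close> supply the factor 3.\<close>
      have "3 \<le> q m"
        using grow[of 2] q_le[of "N + 2" m] m by simp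
      hence "3 / real (q n) \<le> real (q m) / real (q (Suc m))"
        unfolding m by (intro divide_right_mono) auto
      also have "\<dots> \<le> radius \<phi> (q i)"
        using False m that by (intro near_0) auto
      finally show ?thesis
        using n by (intro exI[of _ 0]) simp
    qed
  qed
  have B_le: "x \<le> 1 / 3" if "x \<in> B" for x
  proof -
    obtain n where n: "N + 3 \<le> n" "x = 1 / real (q n)"
      using \<open>x \<in> B\<close> by (auto simp: B_def)
    have "3 \<le> q n" using grow[of 3] q_le[of "N + 3" n] n by simp
    hence "1 / real (q n) \<le> 1 / 3" by (intro divide_left_mono) auto
    thus ?thesis using n by simp
  qed
  have "infinite B"
  proof -
    have "inj (\<lambda>k. 1 / real (q (N + 3 + k)))"
    proof (rule injI)
      fix k l assume eq: "1 / real (q (N + 3 + k)) = 1 / real (q (N + 3 + l))"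
      hence "q (N + 3 + k) = q (N + 3 + l)" by simp
      thus "k = l"
        using q_less[of "N + 3 + k" "N + 3 + l"] q_less[of "N + 3 + l" "N + 3 + k"]
        by (cases k l rule: linorder_cases) auto
    qed
    hence "infinite (range (\<lambda>k. 1 / real (q (N + 3 + k))))"
      by (rule range_inj_infinite)
    moreover have "range (\<lambda>k. 1 / real (q (N + 3 + k))) \<subseteq> B"
      unfolding B_def by (auto intro!: exI[of _ "N + 3 + _"])
    ultimately show ?thesis using finite_subset by blast
  qed
  moreover have "B \<subseteq> E_set \<phi> q"
  proof
    fix x assume x: "x \<in> B"
    show "x \<in> E_set \<phi> q"
    proof (rule E_setI)
      fix i :: nat assume "1 \<le> i"
      moreover have "0 \<le> radius \<phi> (q i)" by (simp add: radius_def)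
      ultimately show "\<exists>g::nat. real g / real (q i) \<le> x \<and> x \<le> real g / real (q i) + radius \<phi> (q i)"
        using B_approx[OF x, of i] by fastforce
    qed (use q_pos B_le[OF x] in auto)
  qed
  moreover have "B + B + B \<subseteq> E_set \<phi> q"
  proof
    fix s assume "s \<in> B + B + B"
    then obtain x y z where xyz: "x \<in> B" "y \<in> B" "z \<in> B" "s = x + y + z"
      by (auto elim!: set_plus_elim)
    show "s \<in> E_set \<phi> q"
    proof (rule E_setI)
      fix i :: nat assume i: "1 \<le> i"
      obtain g h k :: nat where
        "real g / real (q i) \<le> x" "x \<le> real g / real (q i) + radius \<phi> (q i) / 3"
        "real h / real (q i) \<le> y" "y \<le> real h / real (q i) + radius \<phi> (q i) / 3"
        "real k / real (q i) \<le> z" "z \<le> real k / real (q i) + radius \<phi> (q i) / 3"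
        using B_approx[OF xyz(1) i] B_approx[OF xyz(2) i] B_approx[OF xyz(3) i] by blast
      thus "\<exists>g::nat. real g / real (q i) \<le> s \<and> s \<le> real g / real (q i) + radius \<phi> (q i)"
        using xyz(4) by (intro exI[of _ "g + h + k"]) (simp add: add_divide_distrib)
    qed (use q_pos B_le[OF xyz(1)] B_le[OF xyz(2)] B_le[OF xyz(3)] xyz(4) in auto)
  qed

  \<comment> \<open>Long progressions in \<open>E_set\<close>\<close>
  moreover have "erdos_similarity_conclusion (E_set \<phi> q)"
  proof (rule erdos_similarity_if_long_progressions)
    fix L :: nat and e :: real assume "0 < e"
    \<comment> \<open>The progression is \<open>k / q (Suc n)\<close> from 0. The summand
      \<open>N\<close> allows \<open>near_0\<close>, \<open>L\<close> gives
      \<open>L \<le> q n\<close>, and the last makes the step at most \<open>e\<close>.\<close>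
    define n where "n = N + L + nat \<lceil>1 / e\<rceil>"
    have "N \<le> n" unfolding n_def by linarith
    have "L < q (N + L)" by (rule grow)
    hence L: "L \<le> q n" using q_le[of "N + L" n] N by (simp add: n_def)
    have "N + nat \<lceil>1 / e\<rceil> \<le> Suc n" unfolding n_def by linarith
    hence "q (N + nat \<lceil>1 / e\<rceil>) \<le> q (Suc n)" using N(1) by (intro q_le) linarith+
    hence "nat \<lceil>1 / e\<rceil> \<le> q (Suc n)"
      using grow[of "nat \<lceil>1 / e\<rceil>"] by linarith
    hence "1 / e \<le> real (q (Suc n))" by linarith
    hence de: "1 / real (q (Suc n)) \<le> e"
      using \<open>0 < e\<close> q_pos[of "Suc n"] by (simp add: field_simps)
    have "0 + real k * (1 / real (q (Suc n))) \<in> E_set \<phi> q" if "k \<le> L" for k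
    proof (rule E_setI)
      have k: "k \<le> q n" using that L by simp
      have "q n \<le> q (Suc n)" using N(1) \<open>N \<le> n\<close> by (intro q_le) auto
      thus "0 + real k * (1 / real (q (Suc n))) \<le> 1"
        using k q_pos[of "Suc n"] by simp
      fix i :: nat assume i: "1 \<le> i"
      show "\<exists>g::nat. real g / real (q i) \<le> 0 + real k * (1 / real (q (Suc n))) \<and>
          0 + real k * (1 / real (q (Suc n))) \<le> real g / real (q i) + radius \<phi> (q i)"
      proof (cases "Suc n \<le> i")
        case True
        have "real k * (1 / real (q (Suc n))) = real (k * (q i div q (Suc n))) / real (q i)"
          using q_dvd[OF _ True] q_pos[of "Suc n"] q_pos[OF i] by (simp add: real_of_nat_div)
        moreover have "0 \<le> radius \<phi> (q i)" by (simp add: radius_def)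
        ultimately show ?thesis by (intro exI[of _ "k * (q i div q (Suc n))"]) simp
      next
        case False
        have "real k / real (q (Suc n)) \<le> real (q n) / real (q (Suc n))"
          using k by (intro divide_right_mono) auto
        also have "\<dots> \<le> radius \<phi> (q i)"
          using False i \<open>N \<le> n\<close> by (intro near_0) auto
        finally show ?thesis by (intro exI[of _ 0]) simp
      qed
    qed (use q_pos in auto)
    thus "\<exists>a d. 0 < d \<and> d \<le> e \<and> (\<forall>k\<le>L. a + real k * d \<in> E_set \<phi> q)"
      using de q_pos[of "Suc n"] by (intro exI[of _ 0] exI[of _ "1 / real (q (Suc n))"]) auto
  qed
  ultimately show ?thesis by blast
qed

end
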